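(* Let $(X,\mathcal A,m)$ and $(\Omega,\mathcal F,\mathbb P)$ be probability spaces, let $\sigma:\Omega\to\Omega$ be a $\mathbb P$-preserving transformation, let $(P,\sigma)$ be a Markov operator cocycle over $\sigma$ acting on $L^1(X,m)$, and let $S=\{g\in L^\infty(X,m):\|g\|_{L^\infty}\le 1\}$. Then for each $\omega\in\Omega$ such that $P_{\sigma^j\omega}$ is a Markov operator for all $j\ge 0$, and for every $f\in L^1(X,m)$, the following are equivalent: (1) $\|P^{(n)}_\omega f\|_{L^1(X)}\to 0$ as $n\to\infty$; (2) $\int_X fg\,dm=0$ for every $g\in\bigcap_{n\ge 1}P^{(n)*}_\omega S$. Consequently, $(P,\sigma)$ is exact if and only if $\bigcap_{n\ge 1}P^{(n)*}_\omega S=\{c1_X: c\in\mathbb R,\ |c|\le 1\}$ for $\mathbb P$-almost every $\omega\in\Omega$.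
   Context: A Markov operator on $L^1(X,m)$ is a linear positive operator $Q:L^1(X,m)\to L^1(X,m)$ with $\int_X Qf\,dm=\int_X f\,dm$ for all $f$. A Markov operator cocycle $(P,\sigma)$ is given by a measurable map $P:\Omega\times L^1(X,m)\to L^1(X,m)$ such that $P_\omega=P(\omega,\cdot)$ is a Markov operator for $\mathbb P$-almost every $\omega$; set $P^{(n)}_\omega=P_{\sigma^{n-1}\omega}\circ\cdots\circ P_{\sigma\omega}\circ P_\omega$. $P_\omega^*:L^\infty(X,m)\to L^\infty(X,m)$ is the adjoint of $P_\omega$: $\int_X P_\omega f\cdot g\,dm=\int_X f\cdot P_\omega^*g\,dm$ for $f\in L^1(X,m)$, $g\in L^\infty(X,m)$; and $P^{(n)*}_\omega=P^*_\omega\circ P^*_{\sigma\omega}\circ\cdots\circ P^*_{\sigma^{n-1}\omega}$ for $n\ge 1$. $(P,\sigma)$ is exact if for $\mathbb P$-almost every $\omega$ and every $f\in L^1(X,m)$ with $\int_X f\,dm=0$, $\lim_{n\to\infty}\|P^{(n)}_\omega f\|_{L^1(X)}=0$. *)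

theory Defs
  imports "HOL-Probability.Probability"
begin

text \<open>
  Elements of \<open>L\<^sup>1(X,m)\<close> and \<open>L\<^sup>\<infinity>(X,m)\<close> are classes of measurable functions modulo
  equality almost everywhere, represented as sets of functions. Norms, integrals and linear
  combinations are computed on an arbitrarily chosen member of the class.
\<close>

definition ae_class :: "'x measure \<Rightarrow> ('x \<Rightarrow> real) \<Rightarrow> ('x \<Rightarrow> real) set" where
  "ae_class m f = {g \<in> borel_measurable m. AE x in m. g x = f x}"

definition rep :: "('x \<Rightarrow> real) set \<Rightarrow> 'x \<Rightarrow> real" where
  "rep u = (SOME f. f \<in> u)"

definition L1 :: "'x measure \<Rightarrow> ('x \<Rightarrow> real) set set" where
  "L1 m = ae_class m ` {f. integrable m f}"

definition Linf :: "'x measure \<Rightarrow> ('x \<Rightarrow> real) set set" where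
  "Linf m = ae_class m ` {f \<in> borel_measurable m. esssup m (\<lambda>x. ereal \<bar>f x\<bar>) < \<infinity>}"

definition cls_integral :: "'x measure \<Rightarrow> ('x \<Rightarrow> real) set \<Rightarrow> real" where
  "cls_integral m u = (\<integral>x. rep u x \<partial>m)"

definition cls_pairing :: "'x measure \<Rightarrow> ('x \<Rightarrow> real) set \<Rightarrow> ('x \<Rightarrow> real) set \<Rightarrow> real" where
  "cls_pairing m u v = (\<integral>x. rep u x * rep v x \<partial>m)"

definition cls_lincomb ::
  "'x measure \<Rightarrow> real \<Rightarrow> ('x \<Rightarrow> real) set \<Rightarrow> real \<Rightarrow> ('x \<Rightarrow> real) set \<Rightarrow> ('x \<Rightarrow> real) set" where
  "cls_lincomb m a u b v = ae_class m (\<lambda>x. a * rep u x + b * rep v x)"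

definition cls_nonneg :: "'x measure \<Rightarrow> ('x \<Rightarrow> real) set \<Rightarrow> bool" where
  "cls_nonneg m u \<longleftrightarrow> (AE x in m. 0 \<le> rep u x)"

definition L1_norm :: "'x measure \<Rightarrow> ('x \<Rightarrow> real) set \<Rightarrow> real" where
  "L1_norm m u = (\<integral>x. \<bar>rep u x\<bar> \<partial>m)"

definition Linf_norm :: "'x measure \<Rightarrow> ('x \<Rightarrow> real) set \<Rightarrow> ereal" where
  "Linf_norm m g = esssup m (\<lambda>x. ereal \<bar>rep g x\<bar>)"

definition Linf_unit_ball :: "'x measure \<Rightarrow> ('x \<Rightarrow> real) set set" where
  "Linf_unit_ball m = {g \<in> Linf m. Linf_norm m g \<le> 1}"

definition L1_dist :: "'x measure \<Rightarrow> ('x \<Rightarrow> real) set \<Rightarrow> ('x \<Rightarrow> real) set \<Rightarrow> real" where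
  "L1_dist m u v = (\<integral>x. \<bar>rep u x - rep v x\<bar> \<partial>m)"

text \<open>The Borel \<open>\<sigma>\<close>-algebra of the norm topology. Only the \<open>\<sigma>\<close>-algebra is used; the measure
  carried by the result of \<^const>\<open>sigma\<close> is the zero measure.\<close>

definition L1_borel :: "'x measure \<Rightarrow> ('x \<Rightarrow> real) set measure" where
  "L1_borel m = sigma (L1 m) {U. openin (Metric_space.mtopology (L1 m) (L1_dist m)) U}"

definition markov_operator ::
  "'x measure \<Rightarrow> (('x \<Rightarrow> real) set \<Rightarrow> ('x \<Rightarrow> real) set) \<Rightarrow> bool" where
  "markov_operator m Q \<longleftrightarrow>
     Q \<in> L1 m \<rightarrow> L1 m \<and>
     (\<forall>a b. \<forall>u\<in>L1 m. \<forall>v\<in>L1 m. Q (cls_lincomb m a u b v) = cls_lincomb m a (Q u) b (Q v)) \<and>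
     (\<forall>u\<in>L1 m. cls_nonneg m u \<longrightarrow> cls_nonneg m (Q u)) \<and>
     (\<forall>u\<in>L1 m. cls_integral m (Q u) = cls_integral m u)"

text \<open>The adjoint on \<open>L\<^sup>\<infinity>\<close>. The description is proper whenever \<open>Q\<close> is a Markov operator,
  because a Markov operator is bounded and \<open>L\<^sup>\<infinity>\<close> is the dual of \<open>L\<^sup>1\<close>.\<close>

definition adjoint_op ::
  "'x measure \<Rightarrow> (('x \<Rightarrow> real) set \<Rightarrow> ('x \<Rightarrow> real) set) \<Rightarrow> ('x \<Rightarrow> real) set \<Rightarrow> ('x \<Rightarrow> real) set"
  where
  "adjoint_op m Q g =
     (THE h. h \<in> Linf m \<and> (\<forall>u\<in>L1 m. cls_pairing m (Q u) g = cls_pairing m u h))"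

definition measure_preserving_map :: "'w measure \<Rightarrow> ('w \<Rightarrow> 'w) \<Rightarrow> bool" where
  "measure_preserving_map W \<sigma> \<longleftrightarrow>
     \<sigma> \<in> measurable W W \<and> (\<forall>A\<in>sets W. emeasure W (\<sigma> -` A \<inter> space W) = emeasure W A)"

definition markov_operator_cocycle ::
  "'w measure \<Rightarrow> 'x measure \<Rightarrow> ('w \<Rightarrow> ('x \<Rightarrow> real) set \<Rightarrow> ('x \<Rightarrow> real) set) \<Rightarrow> bool" where
  "markov_operator_cocycle W m P \<longleftrightarrow>
     (\<lambda>(\<omega>, u). P \<omega> u) \<in> measurable (W \<Otimes>\<^sub>M L1_borel m) (L1_borel m) \<and>
     (AE \<omega> in W. markov_operator m (P \<omega>))"

primrec cocycle_iter ::
  "('w \<Rightarrow> ('x \<Rightarrow> real) set \<Rightarrow> ('x \<Rightarrow> real) set) \<Rightarrow> ('w \<Rightarrow> 'w) \<Rightarrow> nat \<Rightarrow> 'w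
    \<Rightarrow> ('x \<Rightarrow> real) set \<Rightarrow> ('x \<Rightarrow> real) set" where
  "cocycle_iter P \<sigma> 0 \<omega> = (\<lambda>u. u)"
| "cocycle_iter P \<sigma> (Suc n) \<omega> = P ((\<sigma> ^^ n) \<omega>) \<circ> cocycle_iter P \<sigma> n \<omega>"

primrec adjoint_iter ::
  "'x measure \<Rightarrow> ('w \<Rightarrow> ('x \<Rightarrow> real) set \<Rightarrow> ('x \<Rightarrow> real) set) \<Rightarrow> ('w \<Rightarrow> 'w) \<Rightarrow> nat \<Rightarrow> 'w
    \<Rightarrow> ('x \<Rightarrow> real) set \<Rightarrow> ('x \<Rightarrow> real) set" where
  "adjoint_iter m P \<sigma> 0 \<omega> = (\<lambda>g. g)"
| "adjoint_iter m P \<sigma> (Suc n) \<omega> = adjoint_iter m P \<sigma> n \<omega> \<circ> adjoint_op m (P ((\<sigma> ^^ n) \<omega>))"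

definition exact_cocycle ::
  "'w measure \<Rightarrow> 'x measure \<Rightarrow> ('w \<Rightarrow> ('x \<Rightarrow> real) set \<Rightarrow> ('x \<Rightarrow> real) set) \<Rightarrow> ('w \<Rightarrow> 'w) \<Rightarrow> bool"
  where
  "exact_cocycle W m P \<sigma> \<longleftrightarrow>
     (AE \<omega> in W. \<forall>u\<in>L1 m. cls_integral m u = 0 \<longrightarrow>
        (\<lambda>n. L1_norm m (cocycle_iter P \<sigma> n \<omega> u)) \<longlonglongrightarrow> 0)"

text \<open>The quantities computed on chosen members do not depend on the choice.\<close>

lemma rep_ae_class:
  assumes "f \<in> borel_measurable m"
  shows "rep (ae_class m f) \<in> borel_measurable m" and "AE x in m. rep (ae_class m f) x = f x"
proof -
  have "f \<in> ae_class m f" using assms by (simp add: ae_class_def)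
  then have "rep (ae_class m f) \<in> ae_class m f" unfolding rep_def by (rule someI[where P = "\<lambda>h. h \<in> ae_class m f"])
  then show "rep (ae_class m f) \<in> borel_measurable m" "AE x in m. rep (ae_class m f) x = f x"
    by (simp_all add: ae_class_def)
qed

lemma ae_class_eq_iff:
  assumes "f \<in> borel_measurable m" "g \<in> borel_measurable m"
  shows "ae_class m f = ae_class m g \<longleftrightarrow> (AE x in m. f x = g x)"
proof
  assume "ae_class m f = ae_class m g"
  then have "f \<in> ae_class m g" using assms by (auto simp: ae_class_def)
  then show "AE x in m. f x = g x" by (simp add: ae_class_def)
next
  assume *: "AE x in m. f x = g x"
  have "(AE x in m. h x = f x) \<longleftrightarrow> (AE x in m. h x = g x)" for h
    using * by (auto elim!: eventually_elim2)
  then show "ae_class m f = ae_class m g" by (simp add: ae_class_def)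
qed

lemma cls_integral_ae_class:
  assumes "f \<in> borel_measurable m"
  shows "cls_integral m (ae_class m f) = (\<integral>x. f x \<partial>m)"
  unfolding cls_integral_def using rep_ae_class[OF assms] assms by (intro integral_cong_AE)

lemma cls_pairing_ae_class:
  assumes "f \<in> borel_measurable m" "g \<in> borel_measurable m"
  shows "cls_pairing m (ae_class m f) (ae_class m g) = (\<integral>x. f x * g x \<partial>m)"
  unfolding cls_pairing_def
  using rep_ae_class[OF assms(1)] rep_ae_class[OF assms(2)] assms
  by (intro integral_cong_AE) auto

lemma L1_norm_ae_class:
  assumes "f \<in> borel_measurable m"
  shows "L1_norm m (ae_class m f) = (\<integral>x. \<bar>f x\<bar> \<partial>m)"
  unfolding L1_norm_def using rep_ae_class[OF assms] assms by (intro integral_cong_AE) auto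

lemma Linf_norm_ae_class:
  assumes "f \<in> borel_measurable m"
  shows "Linf_norm m (ae_class m f) = esssup m (\<lambda>x. ereal \<bar>f x\<bar>)"
  unfolding Linf_norm_def using rep_ae_class[OF assms] assms
  by (intro esssup_AE_cong borel_measurable_ereal borel_measurable_abs) auto

lemma cls_lincomb_ae_class:
  assumes [measurable]: "f \<in> borel_measurable m" "g \<in> borel_measurable m"
  shows "cls_lincomb m a (ae_class m f) b (ae_class m g) = ae_class m (\<lambda>x. a * f x + b * g x)"
proof -
  note [measurable] = rep_ae_class(1)[OF assms(1)] rep_ae_class(1)[OF assms(2)]
  show ?thesis unfolding cls_lincomb_def
    using rep_ae_class(2)[OF assms(1)] rep_ae_class(2)[OF assms(2)]
    by (subst ae_class_eq_iff) auto
qed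

lemma L1_dist_ae_class:
  assumes "f \<in> borel_measurable m" "g \<in> borel_measurable m"
  shows "L1_dist m (ae_class m f) (ae_class m g) = (\<integral>x. \<bar>f x - g x\<bar> \<partial>m)"
  unfolding L1_dist_def
  using rep_ae_class[OF assms(1)] rep_ae_class[OF assms(2)] assms
  by (intro integral_cong_AE) auto

lemma L1_dist_eq_norm:
  assumes "u \<in> L1 m" "v \<in> L1 m"
  shows "L1_dist m u v = L1_norm m (cls_lincomb m 1 u (- 1) v)"
proof -
  obtain f g where u: "u = ae_class m f" "integrable m f" and v: "v = ae_class m g" "integrable m g"
    using assms by (auto simp: L1_def)
  have [measurable]: "f \<in> borel_measurable m" "g \<in> borel_measurable m" using u v by auto
  show ?thesis unfolding u v by (simp add: cls_lincomb_ae_class L1_norm_ae_class L1_dist_ae_class)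
qed

lemma Metric_space_L1: "Metric_space (L1 m) (L1_dist m)"
proof
  show "0 \<le> L1_dist m u v" for u v by (simp add: L1_dist_def)
  show "L1_dist m u v = L1_dist m v u" for u v by (simp add: L1_dist_def abs_minus_commute)
next
  fix u v assume "u \<in> L1 m" "v \<in> L1 m"
  then obtain f g where u: "u = ae_class m f" "integrable m f"
      and v: "v = ae_class m g" "integrable m g"
    by (auto simp: L1_def)
  have [measurable]: "f \<in> borel_measurable m" "g \<in> borel_measurable m" using u v by auto
  have "L1_dist m u v = 0 \<longleftrightarrow> (AE x in m. \<bar>f x - g x\<bar> = 0)"
    unfolding u v using u v by (simp add: L1_dist_ae_class integral_nonneg_eq_0_iff_AE)
  then show "L1_dist m u v = 0 \<longleftrightarrow> u = v" unfolding u v by (simp add: ae_class_eq_iff)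
next
  fix u v w assume "u \<in> L1 m" "v \<in> L1 m" "w \<in> L1 m"
  then obtain f g h where u: "u = ae_class m f" "integrable m f"
      and v: "v = ae_class m g" "integrable m g" and w: "w = ae_class m h" "integrable m h"
    by (auto simp: L1_def)
  have [measurable]: "f \<in> borel_measurable m" "g \<in> borel_measurable m" "h \<in> borel_measurable m"
    using u v w by auto
  have "(\<integral>x. \<bar>f x - h x\<bar> \<partial>m) \<le> (\<integral>x. \<bar>f x - g x\<bar> + \<bar>g x - h x\<bar> \<partial>m)"
    using u v w by (intro integral_mono) auto
  also have "\<dots> = (\<integral>x. \<bar>f x - g x\<bar> \<partial>m) + (\<integral>x. \<bar>g x - h x\<bar> \<partial>m)"
    using u v w by (intro Bochner_Integration.integral_add) auto
  finally show "L1_dist m u w \<le> L1_dist m u v + L1_dist m v w"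
    unfolding u v w by (simp add: L1_dist_ae_class)
qed

end

theory Submission
  imports Defs
begin

text \<open>
  If \<open>g = P\<^bsup>(n)*\<^esup> h\<close> with \<open>h\<close> in the unit ball then \<open>\<bar>\<integral>fg\<bar> = \<bar>\<integral>(P\<^bsup>(n)\<^esup> f)h\<bar> \<le> \<parallel>P\<^bsup>(n)\<^esup> f\<parallel>\<close>, so (1) implies (2).
  Conversely let \<open>h\<^sub>n = sgn (P\<^bsup>(n)\<^esup> f)\<close>, so that \<open>\<integral>f \<cdot> P\<^bsup>(n)*\<^esup> h\<^sub>n = \<parallel>P\<^bsup>(n)\<^esup> f\<parallel>\<close>. Tychonoff's theorem gives one
  filter along which, for every \<open>k\<close> and \<open>u\<close>, the pairings of \<open>h\<^sub>n\<close> with the image of \<open>u\<close> under the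
  cocycle from time \<open>k\<close> to time \<open>n\<close> converge; this replaces weak-* sequential compactness, which may
  fail because \<open>L\<^sup>1\<close> need not be separable. For fixed \<open>k\<close> the limit is a functional of norm at most 1
  on \<open>L\<^sup>1\<close>, hence is given by some \<open>g\<^sub>k\<close> in the unit ball, and \<open>g\<^sub>0 = P\<^bsup>(k)*\<^esup> g\<^sub>k\<close> for all \<open>k\<close>. Thus \<open>g\<^sub>0\<close>
  lies in the intersection, and \<open>\<integral>f g\<^sub>0\<close> is the limit of the decreasing sequence \<open>\<parallel>P\<^bsup>(n)\<^esup> f\<parallel>\<close>.
  For exactness, an element \<open>g\<close> of the intersection is tested against \<open>g - \<integral>g\<close>.
\<close>

section \<open>Cluster points of pointwise bounded sequences\<close>

text \<open>By Tychonoff the product of the intervals \<open>{- b i..b i}\<close> is compact, so the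
  sequence \<open>x\<close> has a cluster point \<open>l\<close> in it. The index type may be
  uncountable, so a subsequence converging at all indices need not exist; a filter finer than
  \<open>sequentially\<close> takes its place.\<close>

lemma bounded_family_limit_filter:
  fixes x :: "nat \<Rightarrow> 'i \<Rightarrow> real"
  assumes "\<And>n i. \<bar>x n i\<bar> \<le> b i"
  obtains F l where "F \<noteq> bot" "F \<le> sequentially" "\<And>i. ((\<lambda>n. x n i) \<longlongrightarrow> l i) F"
proof -
  define K where "K = PiE UNIV (\<lambda>i. {- b i..b i})"
  have "compactin (product_topology (\<lambda>i. euclidean) UNIV) K"
    unfolding K_def by (subst compactin_PiE) simp
  then have "compact K"
    by (simp add: euclidean_product_topology)
  moreover have "x n \<in> K" for n
    using assms by (auto simp: K_def abs_le_iff minus_le_iff)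
  moreover have "filtermap x sequentially \<noteq> bot"
    by (simp add: filtermap_bot_iff)
  ultimately obtain l where l: "inf (nhds l) (filtermap x sequentially) \<noteq> bot"
    unfolding compact_filter by (auto simp: eventually_filtermap)
  \<comment> \<open>Generated by the sets of large \<open>n\<close> for which \<open>x n\<close> is
    close to \<open>l\<close>. These sets are never empty, because \<open>l\<close> is a cluster
    point.\<close>
  define F where "F = inf sequentially (filtercomap x (nhds l))"
  have "F \<noteq> bot"
  proof
    assume "F = bot"
    then obtain Q R where Q: "eventually Q sequentially" and R: "eventually R (nhds l)"
        and QR: "\<And>n. Q n \<Longrightarrow> R (x n) \<Longrightarrow> False"
      unfolding F_def trivial_limit_def eventually_inf eventually_filtercomap by blast
    have "eventually (\<lambda>y. \<not> R y) (filtermap x sequentially)"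
      unfolding eventually_filtermap using Q by (rule eventually_mono) (use QR in blast)
    then have "inf (nhds l) (filtermap x sequentially) = bot"
      unfolding trivial_limit_def eventually_inf using R by blast
    with l show False by simp
  qed
  moreover have "((\<lambda>n. x n i) \<longlongrightarrow> l i) F" for i
  proof -
    have "filterlim x (nhds l) F"
      unfolding F_def filterlim_def filtermap_le_iff_le_filtercomap by simp
    moreover have "continuous_on UNIV (\<lambda>y::'i \<Rightarrow> real. y i)"
      by simp
    then have "filterlim (\<lambda>y. y i) (nhds (l i)) (nhds l)"
      by (metis UNIV_I continuous_on_def tendsto_at_iff_tendsto_nhds)
    ultimately show ?thesis
      by (rule filterlim_compose[rotated])
  qed
  ultimately show thesis
    by (intro that[of F l]) (auto simp: F_def)
qed

subsection \<open>The dual of \<open>L\<^sup>1\<close>\<close>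

lemma integrable_mult_bounded:
  fixes f h :: "'a \<Rightarrow> real"
  assumes "integrable m f" and [measurable]: "h \<in> borel_measurable m" and h: "AE x in m. \<bar>h x\<bar> \<le> C"
  shows "integrable m (\<lambda>x. f x * h x)"
proof (rule Bochner_Integration.integrable_bound)
  show "integrable m (\<lambda>x. C * f x)"
    using assms by simp
  show "AE x in m. norm (f x * h x) \<le> norm (C * f x)"
    using h
  proof eventually_elim
    case (elim x)
    then have "\<bar>h x\<bar> * \<bar>f x\<bar> \<le> \<bar>C\<bar> * \<bar>f x\<bar>"
      by (intro mult_right_mono) auto
    then show ?case
      by (simp add: abs_mult mult.commute)
  qed
qed (use assms in simp)

text \<open>The bound makes the set function given by \<open>\<phi>\<close> on indicators absolutely
  continuous, so Radon-Nikodym supplies a density. Linearity and L1-continuity carry the formula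
  from indicators to all integrable functions.\<close>

lemma (in finite_measure) L1_dual_representation:
  fixes \<phi> :: "('a \<Rightarrow> real) \<Rightarrow> real"
  assumes lin: "\<And>a b f g. integrable M f \<Longrightarrow> integrable M g \<Longrightarrow>
      \<phi> (\<lambda>x. a * f x + b * g x) = a * \<phi> f + b * \<phi> g"
    and bound: "\<And>f. integrable M f \<Longrightarrow> \<bar>\<phi> f\<bar> \<le> C * (\<integral>x. \<bar>f x\<bar> \<partial>M)"
  obtains h where "h \<in> borel_measurable M" "AE x in M. \<bar>h x\<bar> \<le> C"
    "\<And>f. integrable M f \<Longrightarrow> \<phi> f = (\<integral>x. f x * h x \<partial>M)"
proof -
  have ind: "integrable M (indicator A :: 'a \<Rightarrow> real)" if "A \<in> sets M" for A
    using that by (simp add: less_top[symmetric])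
  have bound_ind: "\<bar>\<phi> (indicator A)\<bar> \<le> C * measure M A" if "A \<in> sets M" for A
    using bound[OF ind[OF that]] that by simp
  \<comment> \<open>\<open>\<phi>\<close> is shifted by \<open>C\<close> times the integral to become positive, so that Radon--Nikodym applies.\<close>
  define \<mu> where "\<mu> A = C * measure M A + \<phi> (indicator A)" for A
  have \<mu>_nonneg: "0 \<le> \<mu> A" and \<mu>_le: "\<mu> A \<le> 2 * C * measure M A" if "A \<in> sets M" for A
    using bound_ind[OF that] by (auto simp: \<mu>_def)
  have \<mu>_empty: "\<mu> {} = 0"
    using \<mu>_nonneg[of "{}"] \<mu>_le[of "{}"] by simp
  have \<mu>_add: "\<mu> (A \<union> B) = \<mu> A + \<mu> B" if "A \<in> sets M" "B \<in> sets M" "A \<inter> B = {}" for A B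
  proof -
    have "indicator (A \<union> B) = (\<lambda>x. 1 * indicator A x + 1 * indicator B x :: real)"
      using that by (auto simp: fun_eq_iff indicator_def)
    then show ?thesis
      using that lin[OF ind ind, of A B 1 1] by (simp add: \<mu>_def finite_measure_Union algebra_simps)
  qed
  define N where "N = measure_of (space M) (sets M) (\<lambda>A. ennreal (\<mu> A))"
  have [simp]: "sets N = sets M" "space N = space M"
    by (auto simp: N_def)
  have pos: "positive (sets M) (\<lambda>A. ennreal (\<mu> A))"
    by (simp add: positive_def \<mu>_empty)
  \<comment> \<open>A finitely additive \<open>\<mu>\<close> is countably additive once it is
    continuous at the empty set, and this follows from \<open>\<mu>_le\<close> since
    \<open>M\<close> is finite.\<close>
  have "countably_additive (sets M) (\<lambda>A. ennreal (\<mu> A))"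
  proof (rule sets.empty_continuous_imp_countably_additive[OF pos])
    show "additive (sets M) (\<lambda>A. ennreal (\<mu> A))"
      by (auto simp: additive_def \<mu>_add ennreal_plus[symmetric] \<mu>_nonneg simp del: ennreal_plus)
    fix A :: "nat \<Rightarrow> 'a set" assume A: "range A \<subseteq> sets M" "decseq A" "(\<Inter>i. A i) = {}"
    have "(\<lambda>i. 2 * C * measure M (A i)) \<longlonglongrightarrow> 2 * C * measure M (\<Inter>i. A i)"
      by (rule tendsto_mult_left, rule finite_Lim_measure_decseq) (use A in auto)
    then have "(\<lambda>i. 2 * C * measure M (A i)) \<longlonglongrightarrow> 0"
      by (simp add: A(3))
    then have "(\<lambda>i. \<mu> (A i)) \<longlonglongrightarrow> 0"
      by (rule tendsto_sandwich[OF _ _ tendsto_const, rotated 2])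
        (use A \<mu>_le \<mu>_nonneg in \<open>auto intro!: always_eventually\<close>)
    then show "(\<lambda>i. ennreal (\<mu> (A i))) \<longlonglongrightarrow> 0"
      using tendsto_ennrealI by fastforce
  qed simp
  then have emeasure_N: "emeasure N A = ennreal (\<mu> A)" if "A \<in> sets M" for A
    unfolding N_def using that pos by (intro emeasure_measure_of_sigma sets.sigma_algebra_axioms)
  have "finite_measure N"
    by (rule finite_measureI) (simp add: emeasure_N)
  moreover have "absolutely_continuous M N"
  proof (unfold absolutely_continuous_def, rule subsetI)
    fix A assume "A \<in> null_sets M"
    then show "A \<in> null_sets N"
      using \<mu>_le[of A] by (auto simp: null_sets_def emeasure_N measure_def ennreal_neg)
  qed
  ultimately obtain k where k [measurable]: "k \<in> borel_measurable M" and N: "density M k = N"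
    using Radon_Nikodym_finite_measure[of N] by auto
  have "emeasure N (space M) < \<infinity>"
    by (simp add: emeasure_N)
  then have k_fin: "(\<integral>\<^sup>+x. k x \<partial>M) < \<infinity>"
    by (simp flip: N add: emeasure_density cong: nn_integral_cong_simp)
  then have k_AE: "AE x in M. k x \<noteq> \<infinity>"
    using nn_integral_PInf_AE[OF k] by (auto simp: less_top)
  \<comment> \<open>Subtracting \<open>C\<close> undoes the shift in \<open>\<mu>\<close>;
    \<open>enn2real\<close> changes nothing almost everywhere, as \<open>k\<close> is finite
    there.\<close>
  define h where "h x = enn2real (k x) - C" for x
  have [measurable]: "h \<in> borel_measurable M"
    unfolding h_def by measurable
  have k_int: "integrable M (\<lambda>x. enn2real (k x))"
  proof (rule integrableI_nonneg)
    have "(\<integral>\<^sup>+x. ennreal (enn2real (k x)) \<partial>M) = (\<integral>\<^sup>+x. k x \<partial>M)"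
      using k_AE by (intro nn_integral_cong_AE) (auto simp: less_top)
    then show "(\<integral>\<^sup>+x. ennreal (enn2real (k x)) \<partial>M) < \<infinity>"
      using k_fin by simp
  qed auto
  then have h_int: "integrable M h"
    unfolding h_def by simp
  have \<phi>_ind: "\<phi> (indicator A) = (\<integral>x. indicator A x * h x \<partial>M)" if [measurable]: "A \<in> sets M" for A
  proof -
    have int: "integrable M (\<lambda>x. indicator A x * enn2real (k x))"
      using integrable_mult_indicator[OF that k_int] by simp
    have "ennreal (\<mu> A) = (\<integral>\<^sup>+x. k x * indicator A x \<partial>M)"
      by (simp flip: N emeasure_N[OF that] add: emeasure_density)
    also have "\<dots> = (\<integral>\<^sup>+x. ennreal (indicator A x * enn2real (k x)) \<partial>M)"
      using k_AE by (intro nn_integral_cong_AE) (auto simp: less_top indicator_def)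
    also have "\<dots> = ennreal (\<integral>x. indicator A x * enn2real (k x) \<partial>M)"
      using int by (intro nn_integral_eq_integral) auto
    finally have "\<mu> A = (\<integral>x. indicator A x * enn2real (k x) \<partial>M)"
      using \<mu>_nonneg[OF that] by (subst (asm) ennreal_inj) auto
    also have "\<dots> = (\<integral>x. indicator A x * h x + C * indicator A x \<partial>M)"
      by (simp add: h_def algebra_simps)
    also have "\<dots> = (\<integral>x. indicator A x * h x \<partial>M) + C * measure M A"
      using integrable_mult_indicator[OF that h_int] ind[OF that] that by simp
    finally show ?thesis
      by (simp add: \<mu>_def)
  qed
  \<comment> \<open>The bound on \<open>\<phi> (indicator A)\<close> says that \<open>C - h\<close>
    and \<open>C + h\<close> have nonnegative integral over every measurable \<open>A\<close>; hence
    both are nonnegative almost everywhere.\<close>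
  have "AE x in M. 0 \<le> C - h x"
  proof (rule density_nonneg)
    fix A assume A [measurable]: "A \<in> sets M"
    have "set_lebesgue_integral M A (\<lambda>x. C - h x) = C * measure M A - \<phi> (indicator A)"
      using integrable_mult_indicator[OF A h_int] ind[OF A]
      by (simp add: set_lebesgue_integral_def \<phi>_ind algebra_simps)
    then show "0 \<le> set_lebesgue_integral M A (\<lambda>x. C - h x)"
      using bound_ind[OF A] by simp
  qed (simp add: h_int)
  moreover have "AE x in M. 0 \<le> C + h x"
  proof (rule density_nonneg)
    fix A assume A [measurable]: "A \<in> sets M"
    have "set_lebesgue_integral M A (\<lambda>x. C + h x) = C * measure M A + \<phi> (indicator A)"
      using integrable_mult_indicator[OF A h_int] ind[OF A]
      by (simp add: set_lebesgue_integral_def \<phi>_ind algebra_simps)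
    then show "0 \<le> set_lebesgue_integral M A (\<lambda>x. C + h x)"
      using bound_ind[OF A] by simp
  qed (simp add: h_int)
  ultimately have h_le: "AE x in M. \<bar>h x\<bar> \<le> C"
    by eventually_elim auto
  have int_h: "integrable M (\<lambda>x. f x * h x)" if "integrable M f" for f
    using that \<open>h \<in> borel_measurable M\<close> h_le by (rule integrable_mult_bounded)
  have "\<phi> f = (\<integral>x. f x * h x \<partial>M)" if "integrable M f" for f
    using that
  proof (induction rule: integrable_induct)
    case (base A c)
    have "\<phi> (\<lambda>x. indicator A x *\<^sub>R c) = \<phi> (\<lambda>x. c * indicator A x + 0 * indicator A x)"
      by (simp add: mult.commute)
    also have "\<dots> = c * \<phi> (indicator A)"
      using base by (subst lin) (auto simp: ind)
    finally show ?case
      using base by (simp add: \<phi>_ind mult.assoc mult.left_commute[of _ c])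
  next
    case (add f g)
    then show ?case
      using lin[of f g 1 1] int_h[of f] int_h[of g] by (simp add: distrib_right)
  next
    case (lim f s)
    have [measurable]: "f \<in> borel_measurable M" "s i \<in> borel_measurable M" for i
      using lim by auto
    \<comment> \<open>The induction rule gives
      \<open>\<bar>s i x\<bar> \<le> 2 * \<bar>f x\<bar>\<close>, whence the factor 3 in the
      dominating function.\<close>
    have diff: "(\<lambda>i. \<integral>x. \<bar>s i x - f x\<bar> \<partial>M) \<longlonglongrightarrow> (\<integral>x. 0 \<partial>M)"
    proof (rule integral_dominated_convergence[where w = "\<lambda>x. 3 * \<bar>f x\<bar>"])
      show "AE x in M. (\<lambda>i. \<bar>s i x - f x\<bar>) \<longlonglongrightarrow> 0"
        using lim.hyps(2) by (intro AE_I2 tendsto_rabs_zero LIM_zero)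
      show "AE x in M. norm \<bar>s i x - f x\<bar> \<le> 3 * \<bar>f x\<bar>" for i
      proof (rule AE_I2)
        fix x assume "x \<in> space M"
        then show "norm \<bar>s i x - f x\<bar> \<le> 3 * \<bar>f x\<bar>"
          using lim.hyps(3)[of x i] abs_triangle_ineq4[of "s i x" "f x"] by simp
      qed
    qed (use lim in auto)
    \<comment> \<open>Stated for a general \<open>\<psi>\<close> because it is applied to both sides
      of the formula: \<open>\<phi>\<close> and integration against \<open>h\<close> are each
      Lipschitz with constant \<open>C\<close>.\<close>
    have to_f: "(\<lambda>i. \<psi> (s i)) \<longlonglongrightarrow> \<psi> f"
      if "\<And>i. \<bar>\<psi> (s i) - \<psi> f\<bar> \<le> C * (\<integral>x. \<bar>s i x - f x\<bar> \<partial>M)" for \<psi> :: "('a \<Rightarrow> real) \<Rightarrow> real"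
    proof (rule LIM_zero_cancel, rule Lim_null_comparison)
      show "(\<lambda>i. C * (\<integral>x. \<bar>s i x - f x\<bar> \<partial>M)) \<longlonglongrightarrow> 0"
        using tendsto_mult_left[OF diff, of C] by simp
    qed (use that in \<open>auto intro: always_eventually\<close>)
    have "(\<lambda>i. \<phi> (s i)) \<longlonglongrightarrow> \<phi> f"
    proof (rule to_f)
      fix i
      show "\<bar>\<phi> (s i) - \<phi> f\<bar> \<le> C * (\<integral>x. \<bar>s i x - f x\<bar> \<partial>M)"
        using lin[OF lim.hyps(1)[of i] lim.hyps(4), of 1 "-1"] bound[of "\<lambda>x. s i x - f x"] lim.hyps(1,4) by simp
    qed
    moreover have "(\<lambda>i. \<integral>x. s i x * h x \<partial>M) \<longlonglongrightarrow> (\<integral>x. f x * h x \<partial>M)"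
    proof (rule to_f[of "\<lambda>f. \<integral>x. f x * h x \<partial>M"])
      fix i
      have sf: "integrable M (\<lambda>x. s i x - f x)"
        using lim by auto
      have "(\<integral>x. s i x * h x \<partial>M) - (\<integral>x. f x * h x \<partial>M) = (\<integral>x. (s i x - f x) * h x \<partial>M)"
        using int_h[OF lim.hyps(1)[of i]] int_h[OF lim.hyps(4)] by (simp add: left_diff_distrib)
      also have "\<bar>\<dots>\<bar> \<le> (\<integral>x. \<bar>(s i x - f x) * h x\<bar> \<partial>M)"
        by (rule integral_abs_bound)
      also have "\<dots> \<le> (\<integral>x. C * \<bar>s i x - f x\<bar> \<partial>M)"
      proof (rule integral_mono_AE)
        show "AE x in M. \<bar>(s i x - f x) * h x\<bar> \<le> C * \<bar>s i x - f x\<bar>"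
          using h_le by eventually_elim (simp add: abs_mult mult.commute mult_right_mono)
      qed (use int_h[OF sf] sf in auto)
      finally show "\<bar>(\<integral>x. s i x * h x \<partial>M) - (\<integral>x. f x * h x \<partial>M)\<bar> \<le> C * (\<integral>x. \<bar>s i x - f x\<bar> \<partial>M)"
        by simp
    qed
    ultimately show ?case
      using lim.IH LIMSEQ_unique by simp
  qed
  then show thesis
    by (rule that[OF \<open>h \<in> borel_measurable M\<close> h_le])
qed

section \<open>Classes of functions, their pairing and duality\<close>

lemma L1E:
  assumes "u \<in> L1 m"
  obtains f where "integrable m f" "f \<in> borel_measurable m" "u = ae_class m f"
  using assms by (auto simp: L1_def)

lemma ae_class_in_L1: "integrable m f \<Longrightarrow> ae_class m f \<in> L1 m"
  by (auto simp: L1_def)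

lemma LinfE:
  assumes "g \<in> Linf m"
  obtains h C where "h \<in> borel_measurable m" "AE x in m. \<bar>h x\<bar> \<le> C" "g = ae_class m h"
proof -
  obtain h where h: "h \<in> borel_measurable m" "esssup m (\<lambda>x. ereal \<bar>h x\<bar>) < \<infinity>" "g = ae_class m h"
    using assms by (auto simp: Linf_def)
  then obtain C where C: "esssup m (\<lambda>x. ereal \<bar>h x\<bar>) \<le> ereal C"
    by (metis less_PInf_Ex_of_nat less_imp_le less_irrefl)
  have "AE x in m. ereal \<bar>h x\<bar> \<le> ereal C"
    using esssup_AE[of "\<lambda>x. ereal \<bar>h x\<bar>" m] by eventually_elim (use C order_trans in blast)
  with h show thesis
    by (intro that) simp_all
qed

lemma ae_class_in_Linf_unit_ball:
  assumes [measurable]: "h \<in> borel_measurable m" and "AE x in m. \<bar>h x\<bar> \<le> 1"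
  shows "ae_class m h \<in> Linf_unit_ball m"
proof -
  have "esssup m (\<lambda>x. ereal \<bar>h x\<bar>) \<le> 1"
    using assms(2) by (intro esssup_I) auto
  moreover from this have "esssup m (\<lambda>x. ereal \<bar>h x\<bar>) < \<infinity>"
    by (rule le_less_trans) simp
  ultimately show ?thesis
    by (auto simp: Linf_unit_ball_def Linf_def Linf_norm_ae_class)
qed

lemma Linf_unit_ballE:
  assumes "g \<in> Linf_unit_ball m"
  obtains h where "h \<in> borel_measurable m" "AE x in m. \<bar>h x\<bar> \<le> 1" "g = ae_class m h"
proof -
  obtain h where h: "h \<in> borel_measurable m" "g = ae_class m h"
    using assms by (auto simp: Linf_unit_ball_def Linf_def)
  then have C: "esssup m (\<lambda>x. ereal \<bar>h x\<bar>) \<le> 1"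
    using assms by (simp add: Linf_unit_ball_def Linf_norm_ae_class)
  have "AE x in m. ereal \<bar>h x\<bar> \<le> 1"
    using esssup_AE[of "\<lambda>x. ereal \<bar>h x\<bar>" m] by eventually_elim (use C order_trans in blast)
  with h show thesis
    by (intro that) simp_all
qed

lemma L1_norm_nonneg: "0 \<le> L1_norm m u"
  by (simp add: L1_norm_def)

lemma cls_lincomb_in_L1: "u \<in> L1 m \<Longrightarrow> v \<in> L1 m \<Longrightarrow> cls_lincomb m a u b v \<in> L1 m"
  by (elim L1E) (auto simp: cls_lincomb_ae_class intro!: ae_class_in_L1)

lemma cls_pairing_lincomb:
  assumes "u \<in> L1 m" "v \<in> L1 m" "g \<in> Linf_unit_ball m"
  shows "cls_pairing m (cls_lincomb m a u b v) g = a * cls_pairing m u g + b * cls_pairing m v g"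
proof -
  obtain f f' h where f: "integrable m f" "u = ae_class m f" and f': "integrable m f'" "v = ae_class m f'"
    and h: "h \<in> borel_measurable m" "AE x in m. \<bar>h x\<bar> \<le> 1" "g = ae_class m h"
    using assms by (elim L1E Linf_unit_ballE) blast
  have [measurable]: "f \<in> borel_measurable m" "f' \<in> borel_measurable m"
    using f f' by auto
  show ?thesis
    using integrable_mult_bounded[OF f(1) h(1,2)] integrable_mult_bounded[OF f'(1) h(1,2)] h(1)
    by (simp add: f(2) f'(2) h(3) cls_lincomb_ae_class cls_pairing_ae_class distrib_right mult.assoc)
qed

lemma abs_cls_pairing_le:
  assumes "u \<in> L1 m" "g \<in> Linf_unit_ball m"
  shows "\<bar>cls_pairing m u g\<bar> \<le> L1_norm m u"
proof -
  obtain f h where f: "integrable m f" "u = ae_class m f"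
    and h: "h \<in> borel_measurable m" "AE x in m. \<bar>h x\<bar> \<le> 1" "g = ae_class m h"
    using assms by (elim L1E Linf_unit_ballE) blast
  have "\<bar>\<integral>x. f x * h x \<partial>m\<bar> \<le> (\<integral>x. \<bar>f x * h x\<bar> \<partial>m)"
    by (rule integral_abs_bound)
  also have "\<dots> \<le> (\<integral>x. \<bar>f x\<bar> \<partial>m)"
  proof (rule integral_mono_AE)
    show "AE x in m. \<bar>f x * h x\<bar> \<le> \<bar>f x\<bar>"
      using h(2) by eventually_elim (simp add: abs_mult mult_left_le)
  qed (use integrable_mult_bounded[OF f(1) h(1,2)] f in auto)
  finally show ?thesis
    using f h by (simp add: cls_pairing_ae_class L1_norm_ae_class)
qed

text \<open>The sign of a representative turns \<open>abs_cls_pairing_le\<close> into an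
  equality.\<close>

lemma L1_norm_attained:
  assumes "u \<in> L1 m"
  obtains g where "g \<in> Linf_unit_ball m" "cls_pairing m u g = L1_norm m u"
proof -
  obtain f where f [measurable]: "f \<in> borel_measurable m" "u = ae_class m f"
    using assms by (elim L1E)
  have "cls_pairing m u (ae_class m (\<lambda>x. sgn (f x))) = L1_norm m u"
    by (simp add: f(2) cls_pairing_ae_class L1_norm_ae_class abs_sgn mult.commute)
  moreover have "ae_class m (\<lambda>x. sgn (f x)) \<in> Linf_unit_ball m"
    by (intro ae_class_in_Linf_unit_ball) (auto simp: abs_sgn_eq)
  ultimately show thesis
    by (rule that[rotated])
qed

text \<open>Pairing with the sign of the difference \<open>h - h'\<close>, which is integrable on a
  finite measure space, yields the L1 norm of that difference.\<close>

lemma (in finite_measure) Linf_eqI: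
  assumes "g \<in> Linf M" "g' \<in> Linf M"
    and eq: "\<And>u. u \<in> L1 M \<Longrightarrow> cls_pairing M u g = cls_pairing M u g'"
  shows "g = g'"
proof -
  obtain h C where h: "h \<in> borel_measurable M" "AE x in M. \<bar>h x\<bar> \<le> C" "g = ae_class M h"
    using assms(1) by (elim LinfE)
  obtain h' C' where h': "h' \<in> borel_measurable M" "AE x in M. \<bar>h' x\<bar> \<le> C'" "g' = ae_class M h'"
    using assms(2) by (elim LinfE)
  note [measurable] = h(1) h'(1)
  define s where "s x = sgn (h x - h' x)" for x
  have [measurable]: "s \<in> borel_measurable M"
    unfolding s_def by measurable
  have s: "integrable M s"
    by (rule integrable_const_bound[where B = 1]) (auto simp: s_def abs_sgn_eq)
  have sh: "integrable M (\<lambda>x. s x * h x)" "integrable M (\<lambda>x. s x * h' x)"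
    using integrable_mult_bounded[OF s] h h' by auto
  have abs_eq: "\<bar>h x - h' x\<bar> = s x * h x - s x * h' x" for x
    by (simp add: s_def abs_sgn algebra_simps)
  have "(\<integral>x. \<bar>h x - h' x\<bar> \<partial>M) = cls_pairing M (ae_class M s) g - cls_pairing M (ae_class M s) g'"
    using sh by (simp add: abs_eq h(3) h'(3) cls_pairing_ae_class)
  also have "\<dots> = 0"
    using eq[OF ae_class_in_L1[OF s]] by simp
  finally have "AE x in M. \<bar>h x - h' x\<bar> = 0"
    using Bochner_Integration.integrable_diff[OF sh]
    by (subst (asm) integral_nonneg_eq_0_iff_AE) (simp_all flip: abs_eq)
  then show ?thesis
    by (simp add: h(3) h'(3) ae_class_eq_iff)
qed

lemma (in finite_measure) Linf_unit_ball_representation: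
  assumes lin: "\<And>a b u v. u \<in> L1 M \<Longrightarrow> v \<in> L1 M \<Longrightarrow>
      \<Lambda> (cls_lincomb M a u b v) = a * \<Lambda> u + b * \<Lambda> v"
    and bound: "\<And>u. u \<in> L1 M \<Longrightarrow> \<bar>\<Lambda> u\<bar> \<le> L1_norm M u"
  obtains g where "g \<in> Linf_unit_ball M" "\<And>u. u \<in> L1 M \<Longrightarrow> \<Lambda> u = cls_pairing M u g"
proof -
  obtain h where h: "h \<in> borel_measurable M" "AE x in M. \<bar>h x\<bar> \<le> 1"
    "\<And>f. integrable M f \<Longrightarrow> \<Lambda> (ae_class M f) = (\<integral>x. f x * h x \<partial>M)"
  proof (rule L1_dual_representation[of "\<lambda>f. \<Lambda> (ae_class M f)" 1])
    fix a b :: real and f g :: "'a \<Rightarrow> real" assume "integrable M f" "integrable M g"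
    then show "\<Lambda> (ae_class M (\<lambda>x. a * f x + b * g x)) = a * \<Lambda> (ae_class M f) + b * \<Lambda> (ae_class M g)"
      using lin[of "ae_class M f" "ae_class M g" a b]
      by (simp add: ae_class_in_L1 cls_lincomb_ae_class)
  next
    fix f :: "'a \<Rightarrow> real" assume "integrable M f"
    then show "\<bar>\<Lambda> (ae_class M f)\<bar> \<le> 1 * (\<integral>x. \<bar>f x\<bar> \<partial>M)"
      using bound[of "ae_class M f"] by (simp add: ae_class_in_L1 L1_norm_ae_class)
  qed blast
  show thesis
  proof (rule that)
    show "ae_class M h \<in> Linf_unit_ball M"
      using h by (intro ae_class_in_Linf_unit_ball)
    show "\<Lambda> u = cls_pairing M u (ae_class M h)" if "u \<in> L1 M" for u
      using that h(1,3) by (elim L1E) (simp add: cls_pairing_ae_class)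
  qed
qed

subsection \<open>Markov operators, adjoints and cocycles\<close>

lemma markov_operatorD:
  assumes "markov_operator m Q"
  shows "u \<in> L1 m \<Longrightarrow> Q u \<in> L1 m"
    and "u \<in> L1 m \<Longrightarrow> v \<in> L1 m \<Longrightarrow> Q (cls_lincomb m a u b v) = cls_lincomb m a (Q u) b (Q v)"
    and "u \<in> L1 m \<Longrightarrow> cls_nonneg m u \<Longrightarrow> cls_nonneg m (Q u)"
    and "u \<in> L1 m \<Longrightarrow> cls_integral m (Q u) = cls_integral m u"
  using assms by (auto simp: markov_operator_def)

lemma cls_nonneg_ae_class:
  "f \<in> borel_measurable m \<Longrightarrow> cls_nonneg m (ae_class m f) \<longleftrightarrow> (AE x in m. 0 \<le> f x)"
  unfolding cls_nonneg_def using rep_ae_class(2)[of f m] by (auto elim: eventually_elim2)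

text \<open>Positivity and preservation of the integral preserve the norm of the positive and of the
  negative part; the triangle inequality then gives contraction.\<close>

lemma markov_operator_L1_norm_le:
  assumes Q: "markov_operator m Q" and u: "u \<in> L1 m"
  shows "L1_norm m (Q u) \<le> L1_norm m u"
proof -
  obtain f where f: "integrable m f" "u = ae_class m f" and [measurable]: "f \<in> borel_measurable m"
    using u by (elim L1E)
  let ?p = "\<lambda>x. max 0 (f x)" and ?n = "\<lambda>x. max 0 (- f x)"
  have int: "integrable m ?p" "integrable m ?n"
    using f by auto
  have L1: "ae_class m ?p \<in> L1 m" "ae_class m ?n \<in> L1 m"
    using int by (auto intro!: ae_class_in_L1)
  obtain p where p: "integrable m p" "Q (ae_class m ?p) = ae_class m p" and [measurable]: "p \<in> borel_measurable m"
    using markov_operatorD(1)[OF Q L1(1)] by (elim L1E)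
  obtain n where n: "integrable m n" "Q (ae_class m ?n) = ae_class m n" and [measurable]: "n \<in> borel_measurable m"
    using markov_operatorD(1)[OF Q L1(2)] by (elim L1E)
  have "u = cls_lincomb m 1 (ae_class m ?p) (- 1) (ae_class m ?n)"
    by (simp add: f(2) cls_lincomb_ae_class ae_class_eq_iff)
  then have Qu: "Q u = ae_class m (\<lambda>x. p x - n x)"
    using markov_operatorD(2)[OF Q L1, of 1 "-1"] by (simp add: p(2) n(2) cls_lincomb_ae_class)
  have pos: "AE x in m. 0 \<le> p x" "AE x in m. 0 \<le> n x"
    using markov_operatorD(3)[OF Q L1(1)] markov_operatorD(3)[OF Q L1(2)]
    by (simp_all add: p(2) n(2) cls_nonneg_ae_class)
  have mass: "(\<integral>x. p x \<partial>m) = (\<integral>x. ?p x \<partial>m)" "(\<integral>x. n x \<partial>m) = (\<integral>x. ?n x \<partial>m)"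
    using markov_operatorD(4)[OF Q L1(1)] markov_operatorD(4)[OF Q L1(2)]
    by (simp_all add: p(2) n(2) cls_integral_ae_class)
  have "L1_norm m (Q u) = (\<integral>x. \<bar>p x - n x\<bar> \<partial>m)"
    by (simp add: Qu L1_norm_ae_class)
  \<comment> \<open>The images \<open>p\<close> and \<open>n\<close> may overlap, so they need not
    be the positive and negative parts of \<open>Q u\<close>, and mass can cancel.\<close>
  also have "\<dots> \<le> (\<integral>x. p x + n x \<partial>m)"
    using pos by (intro integral_mono_AE) (auto simp: p n)
  also have "\<dots> = (\<integral>x. ?p x + ?n x \<partial>m)"
    using int p n mass by simp
  also have "\<dots> = L1_norm m u"
    by (auto simp: f(2) L1_norm_ae_class intro!: Bochner_Integration.integral_cong)
  finally show ?thesis .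
qed

text \<open>The functional \<open>\<lambda>u. cls_pairing M (Q u) g\<close> has norm at most 1
  because \<open>Q\<close> contracts, so it is represented in the unit ball. \<open>Linf_eqI\<close>
  gives uniqueness, which makes the \<open>THE\<close> in \<open>adjoint_op\<close>
  meaningful.\<close>

lemma (in finite_measure) adjoint_op_unit_ball:
  assumes Q: "markov_operator M Q" and g: "g \<in> Linf_unit_ball M"
  shows "adjoint_op M Q g \<in> Linf_unit_ball M"
    and "u \<in> L1 M \<Longrightarrow> cls_pairing M (Q u) g = cls_pairing M u (adjoint_op M Q g)"
proof -
  obtain h where h: "h \<in> Linf_unit_ball M" "\<And>u. u \<in> L1 M \<Longrightarrow> cls_pairing M (Q u) g = cls_pairing M u h"
  proof (rule Linf_unit_ball_representation[of "\<lambda>u. cls_pairing M (Q u) g"])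
    fix u assume u: "u \<in> L1 M"
    show "\<bar>cls_pairing M (Q u) g\<bar> \<le> L1_norm M u"
      using abs_cls_pairing_le[OF markov_operatorD(1)[OF Q u] g] markov_operator_L1_norm_le[OF Q u]
      by simp
  qed (use g in \<open>auto simp: markov_operatorD[OF Q] cls_pairing_lincomb\<close>)
  have "adjoint_op M Q g = h"
    unfolding adjoint_op_def
  proof (rule the_equality)
    show "h \<in> Linf M \<and> (\<forall>u\<in>L1 M. cls_pairing M (Q u) g = cls_pairing M u h)"
      using h by (simp add: Linf_unit_ball_def)
    fix h' assume "h' \<in> Linf M \<and> (\<forall>u\<in>L1 M. cls_pairing M (Q u) g = cls_pairing M u h')"
    then show "h' = h"
      using h by (intro Linf_eqI) (simp_all add: Linf_unit_ball_def)
  qed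
  then show "adjoint_op M Q g \<in> Linf_unit_ball M"
    and "u \<in> L1 M \<Longrightarrow> cls_pairing M (Q u) g = cls_pairing M u (adjoint_op M Q g)"
    using h by auto
qed

lemma markov_operator_cocycle_iter:
  assumes "\<And>j. markov_operator m (P ((\<sigma> ^^ j) \<omega>))"
  shows "markov_operator m (cocycle_iter P \<sigma> n \<omega>)"
proof (induction n)
  case 0
  show ?case by (simp add: markov_operator_def)
next
  case (Suc n)
  then show ?case
    using assms[of n] by (simp add: markov_operator_def Pi_iff)
qed

text \<open>Splits the evolution at time \<open>k\<close>. New factors enter at the late end, so the
  induction runs on \<open>n\<close> with \<open>k\<close> fixed.\<close>

lemma cocycle_iter_add:
  "cocycle_iter P \<sigma> (k + n) \<omega> = cocycle_iter P \<sigma> n ((\<sigma> ^^ k) \<omega>) \<circ> cocycle_iter P \<sigma> k \<omega>"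
proof (induction n)
  case (Suc n)
  have "(\<sigma> ^^ n) ((\<sigma> ^^ k) \<omega>) = (\<sigma> ^^ (k + n)) \<omega>"
    by (simp add: funpow_add add.commute[of k])
  with Suc show ?case
    by (simp add: comp_assoc)
qed auto

text \<open>Adjoints compose in reverse order: the newest one acts on \<open>g\<close> first and the
  induction hypothesis is applied to its result, so \<open>g\<close> has to vary.\<close>

lemma (in finite_measure) adjoint_iter_unit_ball:
  assumes P: "\<And>j. markov_operator M (P ((\<sigma> ^^ j) \<omega>))" and "g \<in> Linf_unit_ball M"
  shows "adjoint_iter M P \<sigma> n \<omega> g \<in> Linf_unit_ball M"
    and "u \<in> L1 M \<Longrightarrow>
      cls_pairing M (cocycle_iter P \<sigma> n \<omega> u) g = cls_pairing M u (adjoint_iter M P \<sigma> n \<omega> g)"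
  using assms(2)
proof (induction n arbitrary: g)
  case (Suc n)
  {
    case 1
    then show ?case
      using Suc(1) adjoint_op_unit_ball(1)[OF P] by simp
  next
    case 2
    then show ?case
      using Suc(2) adjoint_op_unit_ball[OF P] markov_operatorD(1)[OF markov_operator_cocycle_iter[of M P \<sigma> \<omega>, OF P]]
      by simp
  }
qed simp_all

section \<open>The equivalence along one orbit\<close>

lemma (in finite_measure) L1_norm_cocycle_tendsto_0_iff:
  assumes P: "\<And>j. markov_operator M (P ((\<sigma> ^^ j) \<omega>))" and f: "f \<in> L1 M"
  shows "(\<lambda>n. L1_norm M (cocycle_iter P \<sigma> n \<omega> f)) \<longlonglongrightarrow> 0 \<longleftrightarrow>
    (\<forall>g \<in> (\<Inter>n\<in>{1..}. adjoint_iter M P \<sigma> n \<omega> ` Linf_unit_ball M). cls_pairing M f g = 0)"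
    (is "?lhs \<longleftrightarrow> (\<forall>g \<in> ?I. _)")
proof -
  note iter = markov_operatorD[OF markov_operator_cocycle_iter[of M P \<sigma> \<omega>, OF P]]
  note adj = adjoint_iter_unit_ball[of P \<sigma> \<omega>, OF P]
  show ?thesis
  proof
    assume lim: ?lhs
    show "\<forall>g \<in> ?I. cls_pairing M f g = 0"
    proof
      fix g assume g: "g \<in> ?I"
      have "\<bar>cls_pairing M f g\<bar> \<le> L1_norm M (cocycle_iter P \<sigma> n \<omega> f)" if "n \<ge> 1" for n
      proof -
        have "g \<in> adjoint_iter M P \<sigma> n \<omega> ` Linf_unit_ball M"
          using INT_D[OF g, of n] that by simp
        then obtain h where "h \<in> Linf_unit_ball M" "g = adjoint_iter M P \<sigma> n \<omega> h"
          by (elim imageE)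
        then show ?thesis
          using adj(2)[of h f n] abs_cls_pairing_le[OF iter(1)[OF f, of n], of h] f by simp
      qed
      then have "\<bar>cls_pairing M f g\<bar> \<le> 0"
        using LIMSEQ_le_const[OF lim] by blast
      then show "cls_pairing M f g = 0"
        by simp
    qed
  next
    assume zero: "\<forall>g \<in> ?I. cls_pairing M f g = 0"
    let ?A = "\<lambda>n. cocycle_iter P \<sigma> n \<omega>" and ?T = "\<lambda>k n. cocycle_iter P \<sigma> n ((\<sigma> ^^ k) \<omega>)"
    have T: "markov_operator M (?T k n)" for k n
    proof (rule markov_operator_cocycle_iter)
      show "markov_operator M (P ((\<sigma> ^^ j) ((\<sigma> ^^ k) \<omega>)))" for j
        using P[of "j + k"] by (simp add: funpow_add)
    qed
    have "\<forall>n. \<exists>h. h \<in> Linf_unit_ball M \<and> cls_pairing M (?A n f) h = L1_norm M (?A n f)"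
      using L1_norm_attained[OF iter(1)[OF f]] by metis
    then obtain h where h: "\<And>n. h n \<in> Linf_unit_ball M"
        and h_eq: "\<And>n. cls_pairing M (?A n f) (h n) = L1_norm M (?A n f)"
      by metis
    \<comment> \<open>The pair \<open>(k, u)\<close> is the index, so a single filter serves all
      starting times. For \<open>n < k\<close> the truncated \<open>n - k\<close> is 0 and
      \<open>?T\<close> is the identity; that value and the default 0 outside \<open>L1 M\<close>
      keep the family bounded by the norm of \<open>u\<close>.\<close>
    define x where "x n i = (case i of (k, u) \<Rightarrow>
        if u \<in> L1 M then cls_pairing M (?T k (n - k) u) (h n) else 0)" for n i
    have x_bound: "\<bar>x n i\<bar> \<le> L1_norm M (snd i)" for n i
      using order_trans[OF abs_cls_pairing_le[OF markov_operatorD(1)[OF T] h] markov_operator_L1_norm_le[OF T]]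
      by (auto simp: x_def L1_norm_nonneg split: prod.split)
    obtain F l where F: "F \<noteq> bot" "F \<le> sequentially"
        and l: "\<And>i. ((\<lambda>n. x n i) \<longlongrightarrow> l i) F"
      using bounded_family_limit_filter[of x, OF x_bound] by blast
    define \<Lambda> where "\<Lambda> k u = l (k, u)" for k u
    have \<Lambda>: "((\<lambda>n. cls_pairing M (?T k (n - k) u) (h n)) \<longlongrightarrow> \<Lambda> k u) F" if "u \<in> L1 M" for k u
    proof -
      have "x n (k, u) = cls_pairing M (?T k (n - k) u) (h n)" for n
        using that by (simp add: x_def)
      then show ?thesis
        using l[of "(k, u)"] by (simp only: \<Lambda>_def)
    qed
    have "\<exists>g. g \<in> Linf_unit_ball M \<and> (\<forall>u\<in>L1 M. \<Lambda> k u = cls_pairing M u g)" for k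
    proof -
      obtain g where "g \<in> Linf_unit_ball M" "\<And>u. u \<in> L1 M \<Longrightarrow> \<Lambda> k u = cls_pairing M u g"
      proof (rule Linf_unit_ball_representation[of "\<Lambda> k"])
        fix a b u v assume uv: "u \<in> L1 M" "v \<in> L1 M"
        have "((\<lambda>n. a * cls_pairing M (?T k (n - k) u) (h n) + b * cls_pairing M (?T k (n - k) v) (h n))
            \<longlongrightarrow> \<Lambda> k (cls_lincomb M a u b v)) F"
          using \<Lambda>[OF cls_lincomb_in_L1[OF uv, of a b], of k]
          by (simp add: markov_operatorD[OF T] uv cls_pairing_lincomb h)
        then show "\<Lambda> k (cls_lincomb M a u b v) = a * \<Lambda> k u + b * \<Lambda> k v"
          by (rule tendsto_unique[OF F(1)]) (intro tendsto_intros \<Lambda> uv)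
      next
        fix u assume u: "u \<in> L1 M"
        show "\<bar>\<Lambda> k u\<bar> \<le> L1_norm M u"
        proof (rule tendsto_upperbound[OF tendsto_rabs[OF \<Lambda>[OF u, of k]] _ F(1)])
          show "\<forall>\<^sub>F n in F. \<bar>cls_pairing M (?T k (n - k) u) (h n)\<bar> \<le> L1_norm M u"
            using order_trans[OF abs_cls_pairing_le[OF markov_operatorD(1)[OF T u] h] markov_operator_L1_norm_le[OF T u]]
            by simp
        qed
      qed blast
      then show ?thesis by blast
    qed
    then obtain g where g: "\<And>k. g k \<in> Linf_unit_ball M"
        and g_eq: "\<And>k u. u \<in> L1 M \<Longrightarrow> \<Lambda> k u = cls_pairing M u (g k)"
      by metis
    \<comment> \<open>Once \<open>n \<ge> k\<close>, which holds eventually along \<open>F\<close>,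
      \<open>?A n\<close> factors as \<open>?T k (n - k)\<close> after \<open>?A k\<close>. Taking
      limits gives \<open>\<Lambda> k (?A k u) = \<Lambda> 0 u\<close>, which is the adjoint
      relation between \<open>g k\<close> and \<open>g 0\<close>.\<close>
    have "g 0 = adjoint_iter M P \<sigma> k \<omega> (g k)" for k
    proof (rule Linf_eqI)
      show "g 0 \<in> Linf M" "adjoint_iter M P \<sigma> k \<omega> (g k) \<in> Linf M"
        using g adj(1)[OF g] by (auto simp: Linf_unit_ball_def)
      fix u assume u: "u \<in> L1 M"
      have "\<forall>\<^sub>F n in F. n \<ge> k"
        using F(2) eventually_ge_at_top by (rule filter_leD)
      then have "\<forall>\<^sub>F n in F. cls_pairing M (?A n u) (h n) = cls_pairing M (?T k (n - k) (?A k u)) (h n)"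
      proof eventually_elim
        case (elim n)
        then show ?case
          using cocycle_iter_add[of P \<sigma> k "n - k" \<omega>] by simp
      qed
      then have "((\<lambda>n. cls_pairing M (?A n u) (h n)) \<longlongrightarrow> \<Lambda> k (?A k u)) F"
        using \<Lambda>[OF iter(1)[OF u]] by (simp add: tendsto_cong)
      moreover have "((\<lambda>n. cls_pairing M (?A n u) (h n)) \<longlongrightarrow> \<Lambda> 0 u) F"
        using \<Lambda>[OF u, of 0] by simp
      ultimately have "\<Lambda> k (?A k u) = \<Lambda> 0 u"
        by (rule tendsto_unique[OF F(1)])
      then show "cls_pairing M u (g 0) = cls_pairing M u (adjoint_iter M P \<sigma> k \<omega> (g k))"
        using adj(2)[OF g u] by (simp add: g_eq u iter(1))
    qed
    then have "g 0 \<in> ?I"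
      using g by blast
    then have "\<Lambda> 0 f = 0"
      using zero g_eq[OF f] by simp
    then have lim_F: "((\<lambda>n. L1_norm M (?A n f)) \<longlongrightarrow> 0) F"
      using \<Lambda>[OF f, of 0] by (simp add: h_eq)
    \<comment> \<open>So far the limit 0 is known only along \<open>F\<close>. Monotonicity provides
      a limit along the whole sequence, and it must agree with the one along the finer
      filter.\<close>
    have "decseq (\<lambda>n. L1_norm M (?A n f))"
      using markov_operator_L1_norm_le[OF P iter(1)[OF f]] by (intro decseq_SucI) simp
    then obtain L where L: "(\<lambda>n. L1_norm M (?A n f)) \<longlonglongrightarrow> L"
      using decseq_convergent[of _ 0] L1_norm_nonneg by metis
    then have "L = 0"
      using tendsto_unique[OF F(1) tendsto_mono[OF F(2) L] lim_F] by simp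
    with L show ?lhs
      by simp
  qed
qed

subsection \<open>Exactness\<close>

lemma (in prob_space) ae_class_const_in_Linf_unit_ball:
  "\<bar>c\<bar> \<le> 1 \<Longrightarrow> ae_class M (\<lambda>_. c) \<in> Linf_unit_ball M"
  by (intro ae_class_in_Linf_unit_ball) auto

lemma cls_pairing_const:
  "u \<in> L1 m \<Longrightarrow> cls_pairing m u (ae_class m (\<lambda>_. c)) = c * cls_integral m u"
  by (elim L1E) (simp add: cls_pairing_ae_class cls_integral_ae_class mult.commute)

text \<open>Pairing with a constant is a multiple of the integral, which Markov operators preserve;
  hence their adjoints fix constants.\<close>

lemma (in prob_space) adjoint_iter_const:
  assumes P: "\<And>j. markov_operator M (P ((\<sigma> ^^ j) \<omega>))" and c: "\<bar>c\<bar> \<le> 1"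
  shows "adjoint_iter M P \<sigma> n \<omega> (ae_class M (\<lambda>_. c)) = ae_class M (\<lambda>_. c)"
proof (rule Linf_eqI)
  note iter = markov_operatorD[OF markov_operator_cocycle_iter[of M P \<sigma> \<omega>, OF P]]
  note adj = adjoint_iter_unit_ball[of P \<sigma> \<omega>, OF P ae_class_const_in_Linf_unit_ball[OF c]]
  show "adjoint_iter M P \<sigma> n \<omega> (ae_class M (\<lambda>_. c)) \<in> Linf M" "ae_class M (\<lambda>_. c) \<in> Linf M"
    using adj(1) ae_class_const_in_Linf_unit_ball[OF c] by (auto simp: Linf_unit_ball_def)
  show "cls_pairing M u (adjoint_iter M P \<sigma> n \<omega> (ae_class M (\<lambda>_. c))) = cls_pairing M u (ae_class M (\<lambda>_. c))"
    if "u \<in> L1 M" for u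
    using that adj(2)[OF that, of n] by (simp add: cls_pairing_const iter)
qed

text \<open>With \<open>c\<close> the mean of \<open>h\<close>, the pairing of \<open>h - c\<close>
  with \<open>g\<close> is the variance of \<open>h\<close>, because \<open>h - c\<close> integrates
  to 0. Zero variance forces \<open>h\<close> to be constant almost everywhere.\<close>

lemma (in prob_space) Linf_unit_ball_constI:
  assumes g: "g \<in> Linf_unit_ball M"
    and zero: "\<And>u. u \<in> L1 M \<Longrightarrow> cls_integral M u = 0 \<Longrightarrow> cls_pairing M u g = 0"
  obtains c where "\<bar>c\<bar> \<le> 1" "g = ae_class M (\<lambda>_. c)"
proof -
  obtain h where h [measurable]: "h \<in> borel_measurable M" and h_le: "AE x in M. \<bar>h x\<bar> \<le> 1"
      and g_eq: "g = ae_class M h"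
    using g by (rule Linf_unit_ballE)
  have h_int: "integrable M h"
    using h_le by (intro integrable_const_bound[where B = 1]) auto
  define c where "c = (\<integral>x. h x \<partial>M)"
  have d_int: "integrable M (\<lambda>x. h x - c)"
    using h_int by simp
  have dh_int: "integrable M (\<lambda>x. (h x - c) * h x)"
    using d_int h h_le by (rule integrable_mult_bounded)
  have sq: "(h x - c)\<^sup>2 = (h x - c) * h x - c * (h x - c)" for x
    by (simp add: power2_eq_square algebra_simps)
  have mean: "(\<integral>x. h x - c \<partial>M) = 0"
    using h_int by (simp add: c_def prob_space)
  have "cls_pairing M (ae_class M (\<lambda>x. h x - c)) g = 0"
    using d_int mean by (intro zero ae_class_in_L1) (simp_all add: cls_integral_ae_class)
  then have "(\<integral>x. (h x - c) * h x \<partial>M) = 0"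
    by (simp add: g_eq cls_pairing_ae_class)
  then have "(\<integral>x. (h x - c)\<^sup>2 \<partial>M) = 0"
    using dh_int d_int mean by (simp add: sq)
  moreover have "integrable M (\<lambda>x. (h x - c)\<^sup>2)"
    using dh_int d_int by (simp add: sq)
  ultimately have "AE x in M. (h x - c)\<^sup>2 = 0"
    by (subst (asm) integral_nonneg_eq_0_iff_AE) auto
  then have eq: "AE x in M. h x = c"
    by simp
  have "AE x in M. \<bar>c\<bar> \<le> 1"
    using h_le eq by eventually_elim simp
  \<comment> \<open>The almost-everywhere statement no longer mentions \<open>x\<close>, and a
    probability space is not null.\<close>
  then have "\<bar>c\<bar> \<le> 1"
    by simp
  with eq show thesis
    by (intro that) (simp_all add: g_eq ae_class_eq_iff)
qed

lemma (in prob_space) cocycle_exact_iff: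
  assumes P: "\<And>j. markov_operator M (P ((\<sigma> ^^ j) \<omega>))"
  shows "(\<forall>u\<in>L1 M. cls_integral M u = 0 \<longrightarrow>
        (\<lambda>n. L1_norm M (cocycle_iter P \<sigma> n \<omega> u)) \<longlonglongrightarrow> 0) \<longleftrightarrow>
    (\<Inter>n\<in>{1..}. adjoint_iter M P \<sigma> n \<omega> ` Linf_unit_ball M) = {ae_class M (\<lambda>_. c) | c. \<bar>c\<bar> \<le> 1}"
    (is "?lhs \<longleftrightarrow> ?I = ?K")
proof -
  \<comment> \<open>Constants are their own preimages under the adjoints, so \<open>?K\<close>
    always lies in \<open>?I\<close>; only the opposite inclusion depends on the decay of
    norms.\<close>
  have K_I: "ae_class M (\<lambda>_. c) \<in> ?I" if "\<bar>c\<bar> \<le> 1" for c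
  proof (rule INT_I)
    fix n :: nat
    show "ae_class M (\<lambda>_. c) \<in> adjoint_iter M P \<sigma> n \<omega> ` Linf_unit_ball M"
      using adjoint_iter_const[of P \<sigma> \<omega> c n, OF P that] ae_class_const_in_Linf_unit_ball[OF that]
      by (rule image_eqI[OF sym])
  qed
  have "?lhs \<longleftrightarrow> (\<forall>u\<in>L1 M. cls_integral M u = 0 \<longrightarrow> (\<forall>g\<in>?I. cls_pairing M u g = 0))"
    by (intro ball_cong imp_cong refl L1_norm_cocycle_tendsto_0_iff P)
  also have "\<dots> \<longleftrightarrow> ?I = ?K"
  proof
    assume zero: "\<forall>u\<in>L1 M. cls_integral M u = 0 \<longrightarrow> (\<forall>g\<in>?I. cls_pairing M u g = 0)"
    show "?I = ?K"
    proof (rule subset_antisym)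
      show "?I \<subseteq> ?K"
      proof
        fix g assume g: "g \<in> ?I"
        \<comment> \<open>The level 1 serves to place \<open>g\<close> itself in the unit
          ball.\<close>
        then have "g \<in> adjoint_iter M P \<sigma> 1 \<omega> ` Linf_unit_ball M"
          by (rule INT_D) simp
        then have "g \<in> Linf_unit_ball M"
          using adjoint_iter_unit_ball(1)[of P \<sigma> \<omega>, OF P] by (elim imageE) (simp only:)
        then obtain c where "\<bar>c\<bar> \<le> 1" "g = ae_class M (\<lambda>_. c)"
          by (rule Linf_unit_ball_constI) (use zero g in metis)+
        then show "g \<in> ?K"
          by blast
      qed
      show "?K \<subseteq> ?I"
        using K_I by (intro subsetI) (elim CollectE exE conjE, simp only:)
    qed
  next
    assume eq: "?I = ?K"
    show "\<forall>u\<in>L1 M. cls_integral M u = 0 \<longrightarrow> (\<forall>g\<in>?I. cls_pairing M u g = 0)"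
      unfolding eq by (auto simp: cls_pairing_const)
  qed
  finally show ?thesis .
qed

section \<open>From almost every point to almost every orbit\<close>

lemma measure_preserving_map_AE:
  assumes "measure_preserving_map W \<sigma>" and "AE \<omega> in W. R \<omega>"
  shows "AE \<omega> in W. R (\<sigma> \<omega>)"
proof (rule AE_distrD[where P = R])
  show \<sigma>: "\<sigma> \<in> measurable W W"
    using assms(1) by (simp add: measure_preserving_map_def)
  have eq: "distr W W \<sigma> = W"
    using assms(1) \<sigma> by (intro measure_eqI) (auto simp: emeasure_distr measure_preserving_map_def)
  show "AE \<omega> in distr W W \<sigma>. R \<omega>"
    unfolding eq by (rule assms(2))
qed

text \<open>Each pullback along an iterate of \<open>\<sigma>\<close> still holds almost everywhere,
  and there are countably many. Applied to \<open>markov_operator\<close>, this supplies the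
  orbitwise hypothesis of the pointwise results.\<close>

lemma measure_preserving_map_AE_orbit:
  assumes "measure_preserving_map W \<sigma>" and "AE \<omega> in W. R \<omega>"
  shows "AE \<omega> in W. \<forall>j. R ((\<sigma> ^^ j) \<omega>)"
proof -
  have "AE \<omega> in W. R ((\<sigma> ^^ j) \<omega>)" for j
  proof (induction j)
    case (Suc j)
    then show ?case
      \<comment> \<open>The iterate is unfolded with \<open>\<sigma>\<close> innermost, so that the
        induction hypothesis is pulled back by one application of \<open>\<sigma>\<close>.\<close>
      using measure_preserving_map_AE[OF assms(1)] by (simp only: funpow_Suc_right comp_def)
  qed (use assms(2) in simp)
  then show ?thesis
    by (simp add: AE_all_countable)
qed

theorem theorem3p1:
  fixes m :: "'x measure" and W :: "'w measure"
    and \<sigma> :: "'w \<Rightarrow> 'w"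
    and P :: "'w \<Rightarrow> ('x \<Rightarrow> real) set \<Rightarrow> ('x \<Rightarrow> real) set"
  assumes "prob_space m" and "prob_space W"
    and "measure_preserving_map W \<sigma>"
    and "markov_operator_cocycle W m P"
  shows "(\<forall>\<omega>\<in>space W. (\<forall>j. markov_operator m (P ((\<sigma> ^^ j) \<omega>))) \<longrightarrow>
            (\<forall>f\<in>L1 m.
               (\<lambda>n. L1_norm m (cocycle_iter P \<sigma> n \<omega> f)) \<longlonglongrightarrow> 0 \<longleftrightarrow>
               (\<forall>g \<in> (\<Inter>n\<in>{1..}. adjoint_iter m P \<sigma> n \<omega> ` Linf_unit_ball m).
                  cls_pairing m f g = 0))) \<and>
         (exact_cocycle W m P \<sigma> \<longleftrightarrow>
            (AE \<omega> in W. (\<Inter>n\<in>{1..}. adjoint_iter m P \<sigma> n \<omega> ` Linf_unit_ball m) =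
               {ae_class m (\<lambda>x. c * indicator (space m) x) | c. \<bar>c\<bar> \<le> 1}))"
proof -
  interpret m: prob_space m by fact
  \<comment> \<open>The indicator equals 1 on all of \<open>space m\<close>, so both functions have
    the same class although they may differ off the space.\<close>
  have const: "ae_class m (\<lambda>x. c * indicator (space m) x) = ae_class m (\<lambda>_. c)" for c
    by (subst ae_class_eq_iff) auto
  have "AE \<omega> in W. \<forall>j. markov_operator m (P ((\<sigma> ^^ j) \<omega>))"
    using assms(3,4) by (intro measure_preserving_map_AE_orbit) (simp_all add: markov_operator_cocycle_def)
  \<comment> \<open>For almost every \<open>\<omega>\<close> the whole orbit is Markov, so the
    equivalence for a fixed \<open>\<omega>\<close> can be substituted under the almost-everywhere
    quantifier.\<close>
  then have "exact_cocycle W m P \<sigma> \<longleftrightarrow>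
      (AE \<omega> in W. (\<Inter>n\<in>{1..}. adjoint_iter m P \<sigma> n \<omega> ` Linf_unit_ball m) =
         {ae_class m (\<lambda>_. c) | c. \<bar>c\<bar> \<le> 1})"
    unfolding exact_cocycle_def
    by (intro eventually_subst, elim eventually_mono) (rule m.cocycle_exact_iff, blast)
  then show ?thesis
    unfolding const by (intro conjI ballI impI m.L1_norm_cocycle_tendsto_0_iff) simp_all
qed

end
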